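(* Let $N\ge1$ and $M_N=2^{\sigma_N}$. Then $$\#(\mathcal{U}_N\bmod M_N)=3\cdot2^{\sigma_N-2}+\sum_{n=1}^{N}|\mathcal{C}_n|\,2^{\sigma_N-\sigma_n},$$ where the left-hand side is the number of residue classes modulo $M_N$ represented by elements of $\mathcal{U}_N$. Consequently, the density $\delta_N=\#(\mathcal{U}_N\bmod M_N)/M_N$ of $\mathcal{U}_N$ in one period is $$\delta_N=\frac34+\sum_{n=1}^{N}\frac{|\mathcal{C}_n|}{2^{\sigma_n}}.$$
   Context: Let $\kappa(n)=\lfloor n\log_2 3\rfloor$ for $n\ge1$ and $\sigma_n=\lfloor 1+(n+1)\log_2 3\rfloor=\kappa(n+1)+1$. For $n\ge1$ let $\mathcal{A}_n$ be the set of integer vectors $\boldsymbol{\alpha}=(\alpha_1,\ldots,\alpha_{n+1})$ with $0=\alpha_1<\cdots<\alpha_{n+1}$ and $\alpha_{i+1}\le\kappa(i)$ for $1\le i\le n$. Let $T:\mathbb{Z}\to\mathbb{Z}$ be $T(x)=x/2$ for even $x$ and $T(x)=(3x+1)/2$ for odd $x$. The parity vector of length $L$ of an integer $x$ has entry $1$ at position $s$ ($0\le s\le L-1$) iff $T^s(x)$ is odd; it depends only on $x$ mod $2^L$ and gives a bijection $\mathbb{Z}/2^L\mathbb{Z}\to\{0,1\}^L$. For $\boldsymbol{\alpha}\in\mathcal{A}_n$ let $c(\boldsymbol{\alpha})$ be the unique element of $\{1,\ldots,2^{\sigma_n}-1\}$ whose parity vector of length $\sigma_n$ has ones precisely at positions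 $\alpha_1,\ldots,\alpha_{n+1}$; put $\mathcal{C}_n=\{c(\boldsymbol{\alpha}):\boldsymbol{\alpha}\in\mathcal{A}_n\}$. For $N\ge1$ the coverage set of order $N$ is the set $\mathcal{U}_N$ of all integers $x\ge2$ such that $x\equiv0\pmod2$, or $x\equiv1\pmod4$, or $x\equiv a\pmod{2^{\sigma_n}}$ for some $1\le n\le N$ and some $a\in\mathcal{C}_n$. (Membership of $x\geq 2$ in $\mathcal{U}_N$ depends only on $x$ mod $2^{\sigma_N}$.) *)

theory Defs
  imports Complex_Main "HOL-Library.FuncSet" "HOL-Number_Theory.Cong"
begin

definition kappa :: "nat \<Rightarrow> nat" where
  "kappa n = nat \<lfloor>real n * log 2 3\<rfloor>"

definition sigma :: "nat \<Rightarrow> nat" where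
  "sigma n = nat \<lfloor>1 + (real n + 1) * log 2 3\<rfloor>"

text \<open>Integer vectors with \<open>n + 1\<close> entries are extensional functions on the index set
  \<open>{1..n+1}\<close>, so that distinct functions are distinct vectors.\<close>

definition adm_vectors :: "nat \<Rightarrow> (nat \<Rightarrow> int) set" where
  "adm_vectors n =
     {\<alpha> \<in> {1..n+1} \<rightarrow>\<^sub>E UNIV.
        \<alpha> 1 = 0 \<and> strict_mono_on {1..n+1} \<alpha> \<and> (\<forall>i\<in>{1..n}. \<alpha> (i + 1) \<le> int (kappa i))}"

definition T :: "int \<Rightarrow> int" where
  "T x = (if even x then x div 2 else (3 * x + 1) div 2)"

definition parity_vector :: "nat \<Rightarrow> int \<Rightarrow> nat list" where
  "parity_vector L x = map (\<lambda>s. if odd ((T ^^ s) x) then 1 else 0) [0..<L]"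

text \<open>The description below determines a unique integer for every \<open>\<alpha> \<in> adm_vectors n\<close>: parity
  vectors of length \<open>L\<close> are in bijection with the residues modulo \<open>2 ^ L\<close>, and the residue \<open>0\<close> is
  excluded because position \<open>0\<close> carries a one.\<close>

definition residue_of :: "nat \<Rightarrow> (nat \<Rightarrow> int) \<Rightarrow> int" where
  "residue_of n \<alpha> =
     (THE a. a \<in> {1..2 ^ sigma n - 1} \<and>
        (\<forall>s<sigma n. parity_vector (sigma n) a ! s = 1 \<longleftrightarrow> int s \<in> \<alpha> ` {1..n+1}))"

definition residue_set :: "nat \<Rightarrow> int set" where
  "residue_set n = residue_of n ` adm_vectors n"

definition coverage_set :: "nat \<Rightarrow> int set" where
  "coverage_set N =
     {x. x \<ge> 2 \<and>
        ([x = 0] (mod 2) \<or> [x = 1] (mod 4) \<or>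
         (\<exists>n\<in>{1..N}. \<exists>a\<in>residue_set n. [x = a] (mod 2 ^ sigma n)))}"

text \<open>Residue classes modulo \<open>2 ^ sigma N\<close> are identified with their least nonnegative
  representatives.\<close>

definition coverage_count :: "nat \<Rightarrow> nat" where
  "coverage_count N = card ((\<lambda>x. x mod 2 ^ sigma N) ` coverage_set N)"

definition coverage_density :: "nat \<Rightarrow> real" where
  "coverage_density N = real (coverage_count N) / 2 ^ sigma N"

end

theory Submission
  imports Defs
begin

text \<open>The congruence \<open>x \<equiv> 0, 1, 2\<close> modulo \<open>4\<close> and the congruences modulo \<open>2 ^ sigma n\<close>
  to the elements of \<open>residue_set n\<close>, for \<open>n = 1, \<dots>, N\<close>, are all conditions on residues
  modulo divisors of \<open>2 ^ sigma N\<close>, so each of them selects a number of residues modulo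
  \<open>2 ^ sigma N\<close> that is immediate to compute (\<open>card_mod_in\<close>). The formula therefore says that
  these \<open>N + 1\<close> conditions exclude each other.

  The reason is visible in the parity sequence \<open>s \<mapsto> odd (T\<^sup>s x)\<close>, whose first
  \<open>L\<close> entries determine and are determined by \<open>x\<close> modulo \<open>2 ^ L\<close>
  (\<open>cong_iff_same_parities\<close>). If \<open>x\<close> lies in a class of \<open>residue_set n\<close> coming from the vector
  \<open>\<alpha>\<close>, there are exactly \<open>n + 1\<close> odd entries before position \<open>sigma n\<close>. On the other hand
  the bound \<open>\<alpha> (i + 1) \<le> kappa i\<close> forces the odd entries to come early: since
  \<open>kappa (m + 1) = sigma m - 1\<close>, for every \<open>m < n\<close> there are at least \<open>m + 2\<close> of them before
  position \<open>sigma m\<close>. Hence \<open>x\<close> cannot lie in a class of \<open>residue_set m\<close> as well. The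
  first instance of the bound, \<open>\<alpha> 2 \<le> kappa 1 = 1\<close>, makes the first two entries odd, that is
  \<open>x \<equiv> 3\<close> modulo \<open>4\<close>, which separates these classes from the classes \<open>0, 1, 2\<close>.\<close>

section \<open>Parity sequences and residues modulo powers of two\<close>

text \<open>Halving loses one binary digit, and multiplication by \<open>3\<close> is invertible modulo a power
  of two; so \<open>T\<close> trades the lowest digit of its argument for one power of two in the modulus.\<close>

lemma cong_Suc_power_iff_T:
  "[x = y] (mod 2 ^ Suc L) \<longleftrightarrow> (odd x \<longleftrightarrow> odd y) \<and> [T x = T y] (mod 2 ^ L)"
proof -
  define u v where "u = x div 2" and "v = y div 2"
  have x: "x = 2 * u + x mod 2" and y: "y = 2 * v + y mod 2"
    by (simp_all add: u_def v_def)
  show ?thesis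
  proof (cases "odd x \<longleftrightarrow> odd y")
    case False
    then have "\<not> 2 dvd x - y" by simp
    then have "\<not> 2 ^ Suc L dvd x - y"
      by (metis dvd_trans dvd_triv_left power_Suc)
    with False show ?thesis by (simp add: cong_iff_dvd_diff)
  next
    case same: True
    then have "x - y = 2 * (u - v)"
      using x y by (auto simp: odd_iff_mod_2_eq_one even_iff_mod_2_eq_zero)
    then have lift: "[x = y] (mod 2 ^ Suc L) \<longleftrightarrow> 2 ^ L dvd u - v"
      by (simp add: cong_iff_dvd_diff del: right_diff_distrib_numeral)
    have "[T x = T y] (mod 2 ^ L) \<longleftrightarrow> 2 ^ L dvd u - v"
    proof (cases "even x")
      case True
      with same show ?thesis
        by (simp add: T_def u_def v_def cong_iff_dvd_diff)
    next
      case False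
      with same x y have "x = 2 * u + 1" "y = 2 * v + 1"
        by (auto simp: odd_iff_mod_2_eq_one)
      then have "T x = 3 * u + 2" "T y = 3 * v + 2"
        by (auto simp: T_def)
      then have "T x - T y = 3 * (u - v)" by simp
      moreover have "coprime (2 ^ L) (3 :: int)" by simp
      ultimately show ?thesis
        by (simp add: cong_iff_dvd_diff coprime_dvd_mult_right_iff
            del: right_diff_distrib_numeral)
    qed
    with lift same show ?thesis by simp
  qed
qed

lemma cong_iff_same_parities:
  "[x = y] (mod 2 ^ L) \<longleftrightarrow> (\<forall>s<L. odd ((T ^^ s) x) \<longleftrightarrow> odd ((T ^^ s) y))"
proof (induction L arbitrary: x y)
  case (Suc L)
  show ?case
    unfolding cong_Suc_power_iff_T Suc.IH
    by (simp add: All_less_Suc2 funpow_Suc_right o_def del: funpow.simps)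
qed auto

lemma ex_prescribed_parities: "\<exists>x. \<forall>s<L. odd ((T ^^ s) x) \<longleftrightarrow> P s"
proof (induction L arbitrary: P)
  case (Suc L)
  obtain y where y: "\<forall>s<L. odd ((T ^^ s) y) \<longleftrightarrow> P (Suc s)"
    using Suc.IH[of "\<lambda>s. P (Suc s)"] by auto
  have "\<exists>x. (odd x \<longleftrightarrow> P 0) \<and> [T x = y] (mod 2 ^ L)"
  proof (cases "P 0")
    case True
    \<comment> \<open>An odd number \<open>2 * u + 1\<close> is mapped to \<open>3 * u + 2\<close>.\<close>
    have "coprime (3 :: int) (2 ^ L)" by simp
    then obtain i :: int where "[3 * i = 1] (mod 2 ^ L)"
      using cong_solve_coprime_int by blast
    then have "[3 * i * (y - 2) + 2 = 1 * (y - 2) + 2] (mod 2 ^ L)"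
      by (intro cong_add cong_mult cong_refl)
    then have "[T (2 * (i * (y - 2)) + 1) = y] (mod 2 ^ L)"
      by (simp add: T_def algebra_simps)
    with True show ?thesis
      by (intro exI[of _ "2 * (i * (y - 2)) + 1"]) simp
  next
    case False
    then show ?thesis by (intro exI[of _ "2 * y"]) (simp add: T_def)
  qed
  then obtain x where "odd x \<longleftrightarrow> P 0" "[T x = y] (mod 2 ^ L)" by blast
  with y have "\<forall>s<Suc L. odd ((T ^^ s) x) \<longleftrightarrow> P s"
    unfolding cong_iff_same_parities
    by (simp add: All_less_Suc2 funpow_Suc_right o_def del: funpow.simps)
  then show ?case by blast
qed simp

section \<open>Positions of the odd steps in the covered classes\<close>

lemma sigma_eq_Suc_kappa: "sigma n = Suc (kappa (Suc n))"
proof -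
  have "0 \<le> \<lfloor>(real n + 1) * log 2 3\<rfloor>" by simp
  then show ?thesis
    by (simp add: sigma_def kappa_def add.commute nat_add_distrib)
qed

lemma kappa_mono: "m \<le> n \<Longrightarrow> kappa m \<le> kappa n"
  unfolding kappa_def by (intro nat_mono floor_mono mult_right_mono) auto

lemma sigma_mono: "m \<le> n \<Longrightarrow> sigma m \<le> sigma n"
  by (simp add: sigma_eq_Suc_kappa kappa_mono)

lemma kappa_1: "kappa 1 = 1"
proof -
  have "log 2 3 < log 2 (2 ^ 2 :: real)" by (subst log_less_cancel_iff) auto
  then have "log 2 3 < real 2" by (simp only: log_pow_cancel)
  moreover have "1 \<le> log 2 (3 :: real)" by (simp add: le_log_iff)
  ultimately have "\<lfloor>log 2 (3 :: real)\<rfloor> = 1" by (simp add: floor_eq_iff)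
  then show ?thesis by (simp add: kappa_def)
qed

lemma two_le_sigma: "2 \<le> sigma n"
  using kappa_mono[of 1 "Suc n"] unfolding kappa_1 by (simp add: sigma_eq_Suc_kappa)

lemma adm_vectors_bounds:
  assumes "\<alpha> \<in> adm_vectors n" and "i \<in> {1..j + 1}" and "j \<in> {1..n}"
  shows "0 \<le> \<alpha> i" and "\<alpha> i \<le> int (kappa j)"
proof -
  have \<alpha>: "\<alpha> 1 = 0" "mono_on {1..n + 1} \<alpha>" "\<alpha> (j + 1) \<le> int (kappa j)"
    using assms by (auto simp: adm_vectors_def strict_mono_on_imp_mono_on)
  have "\<alpha> 1 \<le> \<alpha> i" "\<alpha> i \<le> \<alpha> (j + 1)"
    using assms by (auto intro!: mono_onD[OF \<alpha>(2)])
  with \<alpha> show "0 \<le> \<alpha> i" "\<alpha> i \<le> int (kappa j)" by auto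
qed

text \<open>The definite description in \<open>residue_of\<close> denotes: the prescribed parities are attained by
  some integer, they fix it modulo \<open>2 ^ sigma n\<close>, and its least nonnegative residue is not
  \<open>0\<close>, because \<open>\<alpha> 1 = 0\<close> makes it odd.\<close>

lemma residue_of_properties:
  assumes "\<alpha> \<in> adm_vectors n"
  shows "residue_of n \<alpha> \<in> {1..2 ^ sigma n - 1}"
    and "\<forall>s<sigma n. odd ((T ^^ s) (residue_of n \<alpha>)) \<longleftrightarrow> int s \<in> \<alpha> ` {1..n + 1}"
proof -
  define parities where
    "parities a \<longleftrightarrow> (\<forall>s<sigma n. odd ((T ^^ s) a) \<longleftrightarrow> int s \<in> \<alpha> ` {1..n + 1})" for a
  have residue_of:
    "residue_of n \<alpha> = (THE a. a \<in> {1..2 ^ sigma n - 1} \<and> parities a)"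
    unfolding residue_of_def parities_def parity_vector_def
    by (intro arg_cong[of _ _ The] ext) auto
  obtain x where x: "parities x"
    using ex_prescribed_parities[of "sigma n" "\<lambda>s. int s \<in> \<alpha> ` {1..n + 1}"]
    unfolding parities_def by blast
  define a where "a = x mod 2 ^ sigma n"
  have "[a = x] (mod 2 ^ sigma n)" by (simp add: a_def)
  with x have a: "parities a"
    unfolding cong_iff_same_parities parities_def by simp
  have "int 0 \<in> \<alpha> ` {1..n + 1}"
    using assms by (force simp: adm_vectors_def image_iff)
  moreover have "0 < sigma n" by (simp add: sigma_eq_Suc_kappa)
  ultimately have "odd a"
    using a unfolding parities_def by (auto dest!: spec[of _ 0])
  then have "a \<noteq> 0" by auto
  moreover have "0 \<le> a" "a < 2 ^ sigma n" by (simp_all add: a_def)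
  ultimately have range: "a \<in> {1..2 ^ sigma n - 1}" by auto
  have unique: "b = a" if "b \<in> {1..2 ^ sigma n - 1} \<and> parities b" for b
  proof -
    have "[b = a] (mod 2 ^ sigma n)"
      using that a unfolding cong_iff_same_parities parities_def by simp
    then show ?thesis
      using that range by (auto simp: cong_def)
  qed
  have "residue_of n \<alpha> = a"
    unfolding residue_of using range a unique by (intro the_equality) auto
  with range a show "residue_of n \<alpha> \<in> {1..2 ^ sigma n - 1}"
    and "\<forall>s<sigma n. odd ((T ^^ s) (residue_of n \<alpha>)) \<longleftrightarrow> int s \<in> \<alpha> ` {1..n + 1}"
    by (auto simp: parities_def)
qed

lemma residue_set_subset: "residue_set n \<subseteq> {0..<2 ^ sigma n}"
  using residue_of_properties(1) by (fastforce simp: residue_set_def)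

definition covered_at :: "nat \<Rightarrow> int \<Rightarrow> bool" where
  "covered_at n x \<longleftrightarrow> x mod 2 ^ sigma n \<in> residue_set n"

lemma covered_at_iff_cong:
  "covered_at n x \<longleftrightarrow> (\<exists>a\<in>residue_set n. [x = a] (mod 2 ^ sigma n))"
proof -
  have "a mod 2 ^ sigma n = a" if "a \<in> residue_set n" for a
    using residue_set_subset that by fastforce
  then show ?thesis by (auto simp: covered_at_def cong_def)
qed

lemma covered_at_parities:
  assumes "covered_at n x"
  obtains \<alpha> where "\<alpha> \<in> adm_vectors n"
    and "\<And>s. s < sigma n \<Longrightarrow> odd ((T ^^ s) x) \<longleftrightarrow> int s \<in> \<alpha> ` {1..n + 1}"
proof -
  obtain \<alpha> where "\<alpha> \<in> adm_vectors n" "[x = residue_of n \<alpha>] (mod 2 ^ sigma n)"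
    using assms by (auto simp: covered_at_iff_cong residue_set_def)
  with that residue_of_properties(2) show thesis
    unfolding cong_iff_same_parities by metis
qed

definition odd_steps :: "int \<Rightarrow> nat \<Rightarrow> nat set" where
  "odd_steps x L = {s. s < L \<and> odd ((T ^^ s) x)}"

lemma finite_odd_steps [simp]: "finite (odd_steps x L)"
  by (simp add: odd_steps_def)

lemma card_odd_steps_le:
  assumes "covered_at n x"
  shows "card (odd_steps x (sigma n)) \<le> n + 1"
proof -
  obtain \<alpha> where
    \<alpha>: "\<And>s. s < sigma n \<Longrightarrow> odd ((T ^^ s) x) \<longleftrightarrow> int s \<in> \<alpha> ` {1..n + 1}"
    using assms covered_at_parities by metis
  have "card (odd_steps x (sigma n)) = card (int ` odd_steps x (sigma n))"
    by (simp add: card_image)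
  also have "\<dots> \<le> card (\<alpha> ` {1..n + 1})"
    by (rule card_mono) (auto simp: odd_steps_def \<alpha>)
  also have "\<dots> \<le> card {1..n + 1}" by (rule card_image_le) simp
  finally show ?thesis by simp
qed

text \<open>The first \<open>m + 2\<close> entries of the vector all lie before \<open>sigma m\<close>, since the last of
  them, \<open>\<alpha> (m + 2)\<close>, is at most \<open>kappa (m + 1) = sigma m - 1\<close>.\<close>

lemma card_odd_steps_ge:
  assumes "covered_at n x" and "m < n"
  shows "m + 2 \<le> card (odd_steps x (sigma m))"
proof -
  obtain \<alpha> where \<alpha>: "\<alpha> \<in> adm_vectors n"
    and steps: "\<And>s. s < sigma n \<Longrightarrow> odd ((T ^^ s) x) \<longleftrightarrow> int s \<in> \<alpha> ` {1..n + 1}"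
    using assms covered_at_parities by metis
  have "strict_mono_on {1..n + 1} \<alpha>" using \<alpha> by (simp add: adm_vectors_def)
  then have "inj_on \<alpha> {1..n + 1}" by (rule strict_mono_on_imp_inj_on)
  then have "inj_on \<alpha> {1..m + 2}"
    by (rule inj_on_subset) (use \<open>m < n\<close> in auto)
  then have "m + 2 = card (\<alpha> ` {1..m + 2})" by (simp add: card_image)
  also have "\<dots> \<le> card (int ` odd_steps x (sigma m))"
  proof (rule card_mono)
    show "\<alpha> ` {1..m + 2} \<subseteq> int ` odd_steps x (sigma m)"
    proof (rule image_subsetI)
      fix i assume i: "i \<in> {1..m + 2}"
      then have "0 \<le> \<alpha> i" "\<alpha> i \<le> int (kappa (m + 1))"
        using adm_vectors_bounds[OF \<alpha>, of i "m + 1"] \<open>m < n\<close> by auto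
      then have nat: "\<alpha> i = int (nat (\<alpha> i))" "nat (\<alpha> i) < sigma m"
        by (auto simp: sigma_eq_Suc_kappa)
      moreover have "odd ((T ^^ nat (\<alpha> i)) x)"
        using steps[of "nat (\<alpha> i)"] nat sigma_mono[of m n] i \<open>m < n\<close> by auto
      ultimately show "\<alpha> i \<in> int ` odd_steps x (sigma m)"
        unfolding odd_steps_def by blast
    qed
  qed simp
  finally show ?thesis by (simp add: card_image)
qed

text \<open>For \<open>m < n\<close> the number of odd steps before \<open>sigma m\<close> would be both at most
  \<open>m + 1\<close> and at least \<open>m + 2\<close>.\<close>

lemma covered_at_unique:
  assumes "covered_at m x" and "covered_at n x"
  shows "m = n"
  using assms card_odd_steps_le card_odd_steps_ge
  by (metis add_2_eq_Suc' Suc_eq_plus1 not_less_eq_eq le_trans linorder_neqE_nat order_refl)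

text \<open>Since \<open>0 = \<alpha> 1 < \<alpha> 2 \<le> kappa 1 = 1\<close>, both \<open>x\<close> and \<open>T x\<close> are odd.\<close>

lemma covered_at_mod_4:
  assumes "covered_at n x" and "1 \<le> n"
  shows "x mod 4 = 3"
proof -
  obtain \<alpha> where \<alpha>: "\<alpha> \<in> adm_vectors n"
    and steps: "\<And>s. s < sigma n \<Longrightarrow> odd ((T ^^ s) x) \<longleftrightarrow> int s \<in> \<alpha> ` {1..n + 1}"
    using assms covered_at_parities by metis
  have "\<alpha> 1 = 0" and mono: "strict_mono_on {1..n + 1} \<alpha>"
    using \<alpha> by (auto simp: adm_vectors_def)
  moreover have "\<alpha> 1 < \<alpha> 2"
    using \<open>1 \<le> n\<close> by (intro strict_mono_onD[OF mono]) auto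
  moreover have "\<alpha> 2 \<le> 1"
    using adm_vectors_bounds(2)[OF \<alpha>, of 2 1, unfolded kappa_1] \<open>1 \<le> n\<close> by simp
  ultimately have "\<alpha> 1 = int 0" "\<alpha> 2 = int 1" by auto
  moreover have "\<alpha> 1 \<in> \<alpha> ` {1..n + 1}" "\<alpha> 2 \<in> \<alpha> ` {1..n + 1}"
    using \<open>1 \<le> n\<close> by auto
  ultimately have "odd x" "odd (T x)"
    using steps[of 0] steps[of 1] two_le_sigma[of n] by auto
  then show ?thesis unfolding T_def by presburger
qed

section \<open>Counting residues\<close>

text \<open>Each such \<open>r\<close> is \<open>a + d * q\<close> for exactly one \<open>a \<in> A\<close> and one
  \<open>q \<in> {0..<k}\<close>.\<close>

lemma card_mod_in:
  fixes d k :: int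
  assumes "0 < d" and "0 \<le> k" and "A \<subseteq> {0..<d}"
  shows "card {r \<in> {0..<d * k}. r mod d \<in> A} = card A * nat k"
proof -
  have digits: "a mod d = a" "(a + d * q) mod d = a" "(a + d * q) div d = q" if "a \<in> A" for a q
    using that assms by (auto simp: subset_iff)
  have "bij_betw (\<lambda>(a, q). a + d * q) (A \<times> {0..<k}) {r \<in> {0..<d * k}. r mod d \<in> A}"
  proof (rule bij_betwI[where g = "\<lambda>r. (r mod d, r div d)"])
    show "(\<lambda>(a, q). a + d * q) \<in> A \<times> {0..<k} \<rightarrow> {r \<in> {0..<d * k}. r mod d \<in> A}"
    proof (clarsimp simp: digits, intro conjI)
      fix a q assume "a \<in> A" and q: "0 \<le> q" "q < k"
      then have a: "0 \<le> a" "a < d" using assms by auto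
      then show "0 \<le> a + d * q" using q by simp
      have "d * (q + 1) \<le> d * k" using q \<open>0 < d\<close> by (intro mult_left_mono) auto
      with a show "a + d * q < d * k" by (simp add: distrib_left)
    qed
    show "(\<lambda>r. (r mod d, r div d)) \<in> {r \<in> {0..<d * k}. r mod d \<in> A} \<rightarrow> A \<times> {0..<k}"
    proof -
      have "r div d < k" if "r < d * k" for r
      proof -
        have "d * (r div d) \<le> r"
          using pos_mod_sign[OF \<open>0 < d\<close>, of r] mult_div_mod_eq[of d r] by linarith
        with that have "d * (r div d) < d * k" by linarith
        then show ?thesis using \<open>0 < d\<close> by simp
      qed
      with \<open>0 < d\<close> show ?thesis by (auto simp: pos_imp_zdiv_nonneg_iff)
    qed
  qed (auto simp: digits)
  from bij_betw_same_card[OF this] show ?thesis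
    by (simp add: card_cartesian_product)
qed

lemma card_mod_power_in:
  assumes "l \<le> L" and "A \<subseteq> {0..<2 ^ l}"
  shows "card {r \<in> {0..<2 ^ L :: int}. r mod 2 ^ l \<in> A} = card A * 2 ^ (L - l)"
proof -
  have "(2 :: int) ^ L = 2 ^ l * 2 ^ (L - l)"
    using assms(1) by (simp flip: power_add)
  then show ?thesis
    using card_mod_in[of "2 ^ l" "2 ^ (L - l)" A] assms(2) by (simp add: nat_power_eq)
qed

text \<open>The restriction to \<open>x \<ge> 2\<close> loses no class, because adding one period to a
  representative makes it at least \<open>2\<close>.\<close>

lemma coverage_residues:
  "(\<lambda>x. x mod 2 ^ sigma N) ` coverage_set N =
     {r \<in> {0..<2 ^ sigma N}. r mod 4 \<in> {0, 1, 2}} \<union>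
     (\<Union>n\<in>{1..N}. {r \<in> {0..<2 ^ sigma N}. covered_at n r})"
  (is "?f ` _ = ?R")
proof -
  let ?M = "2 ^ sigma N :: int"
  define cov where "cov x \<longleftrightarrow> x mod 4 \<in> {0, 1, 2} \<or> (\<exists>n\<in>{1..N}. covered_at n x)" for x
  have small: "x mod 4 \<in> {0, 1, 2} \<longleftrightarrow> [x = 0] (mod 2) \<or> [x = 1] (mod 4)" for x :: int
    unfolding cong_def insert_iff empty_iff by presburger
  have coverage: "coverage_set N = {x. 2 \<le> x \<and> cov x}"
    by (simp only: coverage_set_def cov_def small covered_at_iff_cong disj_assoc)
  have dvd4: "4 dvd ?M"
    using le_imp_power_dvd[OF two_le_sigma[of N], of "2 :: int"] by simp
  have periodic: "cov (x mod ?M) \<longleftrightarrow> cov x" for x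
  proof -
    have "covered_at n (x mod ?M) \<longleftrightarrow> covered_at n x" if "n \<in> {1..N}" for n
      using that by (simp add: covered_at_def mod_mod_cancel le_imp_power_dvd sigma_mono)
    then show ?thesis by (simp add: cov_def mod_mod_cancel[OF dvd4])
  qed
  have "?f ` coverage_set N = {r \<in> {0..<?M}. cov r}"
  proof
    show "?f ` coverage_set N \<subseteq> {r \<in> {0..<?M}. cov r}"
      by (auto simp: coverage periodic)
    show "{r \<in> {0..<?M}. cov r} \<subseteq> ?f ` coverage_set N"
    proof
      fix r assume "r \<in> {r \<in> {0..<?M}. cov r}"
      then have r: "0 \<le> r" "r < ?M" "cov r" by auto
      have "4 \<le> ?M" using dvd4 by (rule zdvd_imp_le) simp
      moreover have mod: "(r + ?M) mod ?M = r" using r by simp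
      moreover have "cov (r + ?M)" using periodic[of "r + ?M"] mod r by simp
      ultimately show "r \<in> ?f ` coverage_set N"
        using r by (intro image_eqI[of _ _ "r + ?M"]) (auto simp: coverage)
    qed
  qed
  also have "\<dots> = ?R" by (auto simp: cov_def)
  finally show ?thesis .
qed

lemma coverage_count_eq:
  "coverage_count N =
     3 * 2 ^ (sigma N - 2) + (\<Sum>n=1..N. card (residue_set n) * 2 ^ (sigma N - sigma n))"
proof -
  let ?I = "{0..<2 ^ sigma N :: int}"
  let ?S = "{r \<in> ?I. r mod 4 \<in> {0, 1, 2}}"
  let ?C = "\<lambda>n. {r \<in> ?I. covered_at n r}"
  have fin: "finite {r \<in> ?I. P r}" for P by (rule finite_subset[of _ ?I]) auto
  have "coverage_count N = card (?S \<union> (\<Union>n\<in>{1..N}. ?C n))"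
    by (simp add: coverage_count_def coverage_residues)
  also have "\<dots> = card ?S + card (\<Union>n\<in>{1..N}. ?C n)"
    by (intro card_Un_disjoint finite_UN_I fin) (auto dest: covered_at_mod_4)
  also have "card (\<Union>n\<in>{1..N}. ?C n) = (\<Sum>n=1..N. card (?C n))"
    by (intro card_UN_disjoint ballI fin) (auto dest: covered_at_unique)
  also have "\<dots> = (\<Sum>n=1..N. card (residue_set n) * 2 ^ (sigma N - sigma n))"
    unfolding covered_at_def
    by (intro sum.cong refl card_mod_power_in sigma_mono residue_set_subset) simp
  also have "card ?S = 3 * 2 ^ (sigma N - 2)"
    using card_mod_power_in[OF two_le_sigma[of N], of "{0, 1, 2}"] by simp
  finally show ?thesis .
qed

theorem proposition26:
  fixes N :: nat
  assumes "N \<ge> 1"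
  shows "coverage_count N =
           3 * 2 ^ (sigma N - 2) + (\<Sum>n=1..N. card (residue_set n) * 2 ^ (sigma N - sigma n)) \<and>
         coverage_density N =
           3 / 4 + (\<Sum>n=1..N. real (card (residue_set n)) / 2 ^ sigma n)"
proof (rule conjI[OF coverage_count_eq])
  have quotient: "(2 :: real) ^ (sigma N - l) / 2 ^ sigma N = 1 / 2 ^ l" if "l \<le> sigma N" for l
    using that by (simp add: power_diff)
  have "coverage_density N =
      3 * (2 ^ (sigma N - 2) / 2 ^ sigma N) +
      (\<Sum>n=1..N. card (residue_set n) * (2 ^ (sigma N - sigma n) / 2 ^ sigma N))"
    by (simp add: coverage_density_def coverage_count_eq add_divide_distrib sum_divide_distrib)
  also have "\<dots> = 3 / 4 + (\<Sum>n=1..N. real (card (residue_set n)) / 2 ^ sigma n)"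
    by (simp add: quotient two_le_sigma sigma_mono)
  finally show "coverage_density N =
    3 / 4 + (\<Sum>n=1..N. real (card (residue_set n)) / 2 ^ sigma n)" .
qed

end
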